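(* There are no balanced super-spiders. That is, for all integers $\alpha\ge 3$ and $\beta\ge 1$, $\operatorname{th}_f(T_{\alpha,\beta})\le \operatorname{th}_f(P_{\alpha\beta+1})$.
   Context: All graphs are finite and simple. Full forcing: given a graph $G$ and an initial set $B\subseteq V(G)$ of blue vertices (all others white), in each time step every white vertex having a blue neighbor becomes blue. The full forcing propagation time $\operatorname{pt}_f(G;B)$ is the least number $k\ge 0$ of time steps after which all vertices of $G$ are blue ($\infty$ if this never happens). The full throttling number of $B$ is $\operatorname{th}_f(G;B)=|B|+\operatorname{pt}_f(G;B)$, and $\operatorname{th}_f(G)=\min_{B\subseteq V(G)}\operatorname{th}_f(G;B)$. $P_n$ is the path on $n$ vertices. A spider is a tree with exactly one vertex (the center) of degree greater than 2; the balanced spider $T_{\alpha,\beta}$ is the tree on $\alpha\beta+1$ vertices consisting of a center vertex $c$ and $\alpha\ge 3$ disjoint paths (legs), each with $\beta$ vertices, with $c$ adjacent to exactly one end vertex of each path. A super-spider is a spider $S$ with $\operatorname{th}_f(S)>\operatorname{th}_f(P_{|V(S)|})$. *)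

theory Defs
  imports "Graph_Theory.Graph_Theory" "HOL-Library.Extended_Nat"
begin

text \<open>Finite simple graphs are \<^locale>\<open>pair_graph\<close>s: finite, loop-free, symmetric digraphs
  without parallel arcs, so that \<^const>\<open>out_degree\<close> is the degree.\<close>

subsection \<open>Full forcing and full throttling\<close>

definition full_force_step :: "'a pair_pre_digraph \<Rightarrow> 'a set \<Rightarrow> 'a set" where
  "full_force_step G S = S \<union> {v \<in> pverts G - S. \<exists>u\<in>S. (u, v) \<in> parcs G}"

definition blue_after :: "'a pair_pre_digraph \<Rightarrow> 'a set \<Rightarrow> nat \<Rightarrow> 'a set" where
  "blue_after G B k = (full_force_step G ^^ k) B"

definition pt_f :: "'a pair_pre_digraph \<Rightarrow> 'a set \<Rightarrow> enat" where
  "pt_f G B = (if \<exists>k. pverts G \<subseteq> blue_after G B k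
     then enat (LEAST k. pverts G \<subseteq> blue_after G B k) else \<infinity>)"

definition th_f_set :: "'a pair_pre_digraph \<Rightarrow> 'a set \<Rightarrow> enat" where
  "th_f_set G B = enat (card B) + pt_f G B"

definition th_f :: "'a pair_pre_digraph \<Rightarrow> enat" where
  "th_f G = Min (th_f_set G ` Pow (pverts G))"

subsection \<open>Paths and balanced spiders\<close>

definition path_graph :: "nat \<Rightarrow> nat pair_pre_digraph" where
  "path_graph n = \<lparr> pverts = {..<n},
     parcs = {(i, j). i < n \<and> j < n \<and> (j = Suc i \<or> i = Suc j)} \<rparr>"

text \<open>\<open>Leg i j\<close> is the vertex of leg \<open>i\<close> at distance \<open>j + 1\<close> from the center.\<close>

datatype spider_vertex = Center | Leg nat nat

definition balanced_spider :: "nat \<Rightarrow> nat \<Rightarrow> spider_vertex pair_pre_digraph" where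
  "balanced_spider \<alpha> \<beta> =
    (let E = {(Center, Leg i 0) | i. i < \<alpha> \<and> 0 < \<beta>}
           \<union> {(Leg i j, Leg i (Suc j)) | i j. i < \<alpha> \<and> Suc j < \<beta>}
     in \<lparr> pverts = insert Center {Leg i j | i j. i < \<alpha> \<and> j < \<beta>}, parcs = E \<union> E\<inverse> \<rparr>)"

subsection \<open>Spiders and super-spiders\<close>

text \<open>The library's \<^const>\<open>tree\<close> is about digraph cycles: in a symmetric digraph every edge
  \<open>uv\<close> yields the digraph cycle \<open>u, v, u\<close>. The cycles of a simple graph are the digraph cycles
  of length at least 3.\<close>

definition graph_tree :: "'a pair_pre_digraph \<Rightarrow> bool" where
  "graph_tree G \<longleftrightarrow> pair_graph G \<and> connected (with_proj G) \<and>
     \<not> (\<exists>p. pre_digraph.cycle (with_proj G) p \<and> 3 \<le> length p)"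

definition spider :: "'a pair_pre_digraph \<Rightarrow> bool" where
  "spider G \<longleftrightarrow> graph_tree G \<and> (\<exists>!c. c \<in> pverts G \<and> 2 < out_degree (with_proj G) c)"

definition super_spider :: "'a pair_pre_digraph \<Rightarrow> bool" where
  "super_spider S \<longleftrightarrow> spider S \<and> th_f S > th_f (path_graph (card (pverts S)))"

subsection \<open>Basic facts\<close>

lemma pair_graph_path_graph: "pair_graph (path_graph n)"
proof -
  have "finite (parcs (path_graph n))"
    by (rule finite_subset[of _ "{..<n} \<times> {..<n}"]) (auto simp: path_graph_def)
  then show ?thesis
    by unfold_locales (auto simp: path_graph_def symmetric_def intro: symI)
qed

lemma pverts_balanced_spider:
  "pverts (balanced_spider \<alpha> \<beta>) = insert Center ((\<lambda>(i, j). Leg i j) ` ({..<\<alpha>} \<times> {..<\<beta>}))"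
  by (auto simp: balanced_spider_def Let_def image_iff)

lemma finite_pverts_balanced_spider: "finite (pverts (balanced_spider \<alpha> \<beta>))"
  by (simp add: pverts_balanced_spider)

lemma card_pverts_balanced_spider: "card (pverts (balanced_spider \<alpha> \<beta>)) = \<alpha> * \<beta> + 1"
proof -
  have "card ((\<lambda>(i, j). Leg i j) ` ({..<\<alpha>} \<times> {..<\<beta>})) = \<alpha> * \<beta>"
    by (subst card_image) (auto simp: inj_on_def)
  then show ?thesis
    unfolding pverts_balanced_spider by (subst card_insert_disjoint) auto
qed

lemma pair_graph_balanced_spider: "pair_graph (balanced_spider \<alpha> \<beta>)"
proof -
  let ?V = "pverts (balanced_spider \<alpha> \<beta>)"
  have "parcs (balanced_spider \<alpha> \<beta>) \<subseteq> ?V \<times> ?V"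
    by (auto simp: balanced_spider_def Let_def)
  then have "finite (parcs (balanced_spider \<alpha> \<beta>))"
    by (rule finite_subset) (simp add: finite_pverts_balanced_spider)
  then show ?thesis
    using finite_pverts_balanced_spider[of \<alpha> \<beta>]
    by unfold_locales (auto simp: balanced_spider_def Let_def symmetric_def intro: symI)
qed

end

theory Submission
  imports Defs
begin

text \<open>
  After \<open>k\<close> steps the blue vertices are those at distance at most \<open>k\<close> from \<open>B\<close>, so
  full throttling minimises \<open>b + k\<close> over all covers of the graph by \<open>b\<close> balls of radius \<open>k\<close>.

  On a path a ball has at most \<open>2 k + 1\<close> vertices, so a cover of \<open>P\<close> with \<open>\<alpha> \<beta> + 1\<close> vertices
  satisfies \<open>\<alpha> \<beta> + 1 \<le> b (2 k + 1)\<close>. By an integer form of the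
  inequality between the means, the total \<open>t = b + k\<close> then satisfies
  \<open>2 \<alpha> \<beta> + 2 \<le> t (t + 1)\<close>.

  On the spider the center is put in \<open>B\<close>, and every leg gets \<open>q\<close> further blue vertices at
  distances \<open>2 k + 1, 2 (2 k + 1), \<dots>\<close> from the center. These balls exhaust a leg as soon as
  \<open>\<beta> \<le> q (2 k + 1) + k\<close>, and the total is \<open>1 + \<alpha> q + k\<close>. A single center ball serves the inner
  \<open>k\<close> vertices of all \<open>\<alpha>\<close> legs, and this saving is what pays for the restriction that the legs
  are all treated alike, with an integral number \<open>q\<close> of balls each.

  It remains to find \<open>q\<close> and \<open>k\<close> with \<open>1 + \<alpha> q + k \<le> t\<close> (lemma \<open>balanced_cover_parameters\<close>).
  With \<open>k = t - 1 - \<alpha> q\<close>, the reach \<open>q (2 k + 1) + k\<close> is a concave quadratic in \<open>q\<close>, and the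
  integer nearest to its real maximiser is good enough unless the legs are short
  (\<open>\<beta> < 2 \<alpha>\<close>, where \<open>q = 0\<close> works) or \<open>\<alpha> = 3\<close> and \<open>t \<le> 8\<close> (where \<open>q = 1\<close> works).
\<close>

section \<open>Forcing along walks\<close>

lemma blue_after_0 [simp]: "blue_after G B 0 = B"
  by (simp add: blue_after_def)

lemma blue_after_Suc: "blue_after G B (Suc k) = full_force_step G (blue_after G B k)"
  by (simp add: blue_after_def)

lemma blue_after_walk:
  assumes "p 0 \<in> B"
    and "\<And>i. i < d \<Longrightarrow> (p i, p (Suc i)) \<in> parcs G \<and> p (Suc i) \<in> pverts G"
    and "d \<le> k"
  shows "p d \<in> blue_after G B k"
proof -
  have "p d \<in> blue_after G B d"
    using assms(2)
  proof (induction d)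
    case 0
    then show ?case using assms(1) by simp
  next
    case (Suc d)
    then have "p d \<in> blue_after G B d" by simp
    with Suc.prems[of d] show ?case
      by (auto simp: blue_after_Suc full_force_step_def)
  qed
  moreover have "blue_after G B d \<subseteq> blue_after G B k"
    using assms(3)
    by (induction k rule: dec_induct) (auto simp: blue_after_Suc full_force_step_def)
  ultimately show ?thesis by blast
qed

section \<open>Witnesses for throttling numbers\<close>

lemma th_f_le:
  assumes "finite (pverts G)" "B \<subseteq> pverts G" "pverts G \<subseteq> blue_after G B k"
  shows "th_f G \<le> enat (card B + k)"
proof -
  have "pt_f G B \<le> enat k"
    using assms(3) by (auto simp: pt_f_def intro: Least_le)
  then have "th_f_set G B \<le> enat (card B) + enat k"
    unfolding th_f_set_def by (rule add_left_mono)
  moreover have "th_f G \<le> th_f_set G B"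
    unfolding th_f_def using assms by (intro Min_le) auto
  ultimately show ?thesis by simp
qed

lemma th_f_attained:
  assumes "finite (pverts G)" "th_f G \<noteq> \<infinity>"
  obtains B k where "B \<subseteq> pverts G" "pverts G \<subseteq> blue_after G B k" "th_f G = enat (card B + k)"
proof -
  have "th_f G \<in> th_f_set G ` Pow (pverts G)"
    unfolding th_f_def using assms(1) by (intro Min_in) auto
  then obtain B where B: "B \<subseteq> pverts G" "th_f G = th_f_set G B" by blast
  let ?blue = "\<lambda>k. pverts G \<subseteq> blue_after G B k"
  have ex: "\<exists>k. ?blue k"
    using assms(2) B(2) by (auto simp: th_f_set_def pt_f_def split: if_splits)
  show ?thesis
  proof (rule that)
    show "?blue (LEAST k. ?blue k)" by (rule LeastI_ex[OF ex])
    show "th_f G = enat (card B + (LEAST k. ?blue k))"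
      using ex B(2) by (simp add: th_f_set_def pt_f_def)
  qed (fact B(1))
qed

section \<open>The lower bound for paths\<close>

lemma blue_after_path_graph:
  "blue_after (path_graph n) B k \<subseteq> (\<Union>b\<in>B. {b - k..b + k})"
proof (induction k)
  case 0
  then show ?case by auto
next
  case (Suc k)
  show ?case
  proof
    fix v assume "v \<in> blue_after (path_graph n) B (Suc k)"
    then obtain u where u: "u \<in> blue_after (path_graph n) B k"
      and near: "v = u \<or> v = Suc u \<or> u = Suc v"
      by (auto simp: blue_after_Suc full_force_step_def path_graph_def)
    from u Suc.IH obtain b where "b \<in> B" "b - k \<le> u" "u \<le> b + k" by fastforce
    with near have "b \<in> B" "v \<in> {b - Suc k..b + Suc k}" by auto
    then show "v \<in> (\<Union>b\<in>B. {b - Suc k..b + Suc k})" by blast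
  qed
qed

lemma path_graph_ball_count:
  assumes "B \<subseteq> {..<n}" "{..<n} \<subseteq> blue_after (path_graph n) B k"
  shows "n \<le> card B * (2 * k + 1)"
proof -
  have "finite B" using assms(1) by (rule finite_subset) simp
  have "n = card {..<n}" by simp
  also have "\<dots> \<le> card (\<Union>b\<in>B. {b - k..b + k})"
    using assms(2) blue_after_path_graph \<open>finite B\<close> by (intro card_mono) blast+
  also have "\<dots> \<le> (\<Sum>b\<in>B. card {b - k..b + k})"
    using \<open>finite B\<close> by (rule card_UN_le)
  also have "\<dots> \<le> card B * (2 * k + 1)"
    using sum_bounded_above[of B "\<lambda>b. card {b - k..b + k}" "2 * k + 1"] by auto
  finally show ?thesis .
qed

text \<open>The difference of the two sides is a product of two consecutive integers, hence
  nonnegative.\<close>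
lemma twice_ball_count_le:
  fixes b k :: nat
  shows "2 * (b * (2 * k + 1)) \<le> (b + k) * (b + k + 1)"
proof -
  define d where "d = int b - int k"
  have "0 \<le> d * (d - 1)"
    by (cases "d \<le> 0") (auto intro: mult_nonneg_nonneg mult_nonpos_nonpos)
  also have "d * (d - 1) = int ((b + k) * (b + k + 1)) - int (2 * (b * (2 * k + 1)))"
    by (simp add: d_def algebra_simps)
  finally show ?thesis by linarith
qed

section \<open>Covering the spider from its center\<close>

lemma blue_after_leg:
  assumes "Leg i a \<in> B" "i < \<alpha>" "a < \<beta>" "x < \<beta>" "x \<le> a + k" "a \<le> x + k"
  shows "Leg i x \<in> blue_after (balanced_spider \<alpha> \<beta>) B k"
proof (cases "a \<le> x")
  case True
  have "Leg i (a + (x - a)) \<in> blue_after (balanced_spider \<alpha> \<beta>) B k"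
    using assms True
    by (intro blue_after_walk[where p = "\<lambda>d. Leg i (a + d)"])
      (auto simp: balanced_spider_def Let_def)
  then show ?thesis using True by simp
next
  case False
  have "Leg i (a - (a - x)) \<in> blue_after (balanced_spider \<alpha> \<beta>) B k"
    using assms False
    by (intro blue_after_walk[where p = "\<lambda>d. Leg i (a - d)"])
      (auto simp: balanced_spider_def Let_def)
  then show ?thesis using False by simp
qed

lemma blue_after_center:
  assumes "Center \<in> B" "i < \<alpha>" "x < \<beta>" "x < k"
  shows "Leg i x \<in> blue_after (balanced_spider \<alpha> \<beta>) B k"
proof -
  let ?p = "\<lambda>d. case d of 0 \<Rightarrow> Center | Suc j \<Rightarrow> Leg i j"
  have "?p (Suc x) \<in> blue_after (balanced_spider \<alpha> \<beta>) B k"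
    using assms
    by (intro blue_after_walk[where p = ?p])
      (auto simp: balanced_spider_def Let_def split: nat.splits)
  then show ?thesis by simp
qed

text \<open>The blue vertices of a leg are at the multiples of \<open>2 k + 1\<close> as distances from the center;
  a multiple beyond the leg is replaced by the leaf, which covers no less of the leg.\<close>
lemma th_f_balanced_spider_le:
  assumes "\<beta> \<ge> 1" "\<beta> \<le> q * (2 * k + 1) + k"
  shows "th_f (balanced_spider \<alpha> \<beta>) \<le> enat (1 + \<alpha> * q + k)"
proof -
  let ?S = "balanced_spider \<alpha> \<beta>"
  define a where "a j = min (Suc j * (2 * k + 1)) \<beta> - 1" for j
  define L where "L = (\<lambda>(i, j). Leg i (a j)) ` ({..<\<alpha>} \<times> {..<q})"
  let ?B = "insert Center L"
  have a: "a j < \<beta>" for j using assms(1) by (auto simp: a_def min_def)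
  have "card L \<le> \<alpha> * q"
    unfolding L_def by (rule card_image_le[THEN order_trans]) auto
  then have card: "card ?B \<le> 1 + \<alpha> * q"
    by (simp add: L_def card_insert_if)
  have "th_f ?S \<le> enat (card ?B + k)"
  proof (rule th_f_le[OF finite_pverts_balanced_spider])
    show "?B \<subseteq> pverts ?S"
      using a by (auto simp: L_def pverts_balanced_spider)
    show "pverts ?S \<subseteq> blue_after ?S ?B k"
    proof
      fix v assume "v \<in> pverts ?S"
      then consider "v = Center" | i x where "v = Leg i x" "i < \<alpha>" "x < \<beta>"
        by (auto simp: pverts_balanced_spider)
      then show "v \<in> blue_after ?S ?B k"
      proof cases
        case 1
        then show ?thesis using blue_after_walk[of "\<lambda>_. Center" ?B 0 ?S k] by simp
      next
        case (2 i x)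
        show ?thesis
        proof (cases "x < k")
          case True
          then show ?thesis using 2 by (simp add: blue_after_center)
        next
          case False
          \<comment> \<open>Beyond the ball of the center, the leg is cut into consecutive blocks of
            \<open>2 k + 1\<close> vertices; the block of \<open>x\<close> has number \<open>j\<close>.\<close>
          define j where "j = (x - k) div (2 * k + 1)"
          define y where "y = j * (2 * k + 1)"
          have "y \<le> x - k" unfolding y_def j_def by (rule div_times_less_eq_dividend)
          moreover have "x - k < y + (2 * k + 1)"
            using dividend_less_div_times[of "2 * k + 1" "x - k"] by (simp add: y_def j_def)
          ultimately have y: "y + k \<le> x" "x \<le> y + 3 * k" using False by linarith+
          have "x - k < q * (2 * k + 1)" using 2(3) assms(2) False by linarith
          then have "j < q" unfolding j_def by (simp add: less_mult_imp_div_less)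
          then have "Leg i (a j) \<in> ?B" using 2 by (auto simp: L_def)
          moreover have "a j = min (y + (2 * k + 1)) \<beta> - 1" by (simp add: a_def y_def)
          then have "x \<le> a j + k" "a j \<le> x + k" using y 2(3) by linarith+
          ultimately show ?thesis using 2 a by (simp add: blue_after_leg)
        qed
      qed
    qed
  qed
  also have "\<dots> \<le> enat (1 + \<alpha> * q + k)" using card by simp
  finally show ?thesis .
qed

section \<open>Choosing the number of balls per leg\<close>

text \<open>For long legs, completing the square shows that the reach
  \<open>(2 q + 1) (t - 1 - \<alpha> q) + q\<close> is largest where \<open>2 \<alpha> (2 q + 1) = 2 t + \<alpha> - 1\<close>.
  Rounding \<open>q\<close> to an integer leaves a deviation \<open>e\<close> of at most \<open>2 \<alpha>\<close> in this equation. The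
  resulting loss is affordable because \<open>t \<ge> 2 \<alpha>\<close>, except when both \<open>\<alpha>\<close> and \<open>t\<close> are small.\<close>
lemma long_leg_reach:
  fixes \<alpha> \<beta> t :: int
  assumes "\<alpha> \<ge> 3" "t \<ge> 2 * \<alpha>" and t: "2 * \<alpha> * \<beta> + 2 \<le> t * (t + 1)"
  shows "\<exists>q\<ge>0. \<beta> \<le> (2 * q + 1) * (t - 1 - \<alpha> * q) + q"
proof (cases "\<alpha> = 3 \<and> t \<le> 8")
  case True
  then have "t = 6 \<or> t = 7 \<or> t = 8" using assms by auto
  then have "\<beta> \<le> 3 * (t - 4) + 1" using True t by auto
  then show ?thesis using True by (intro exI[of _ 1]) auto
next
  case False
  define c where "c = 2 * t + \<alpha> - 1"
  define q where "q = c div (4 * \<alpha>)"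
  define e where "e = 2 * \<alpha> * (2 * q + 1) - c"
  have "c = 4 * \<alpha> * q + c mod (4 * \<alpha>)" by (simp add: q_def)
  moreover have "0 \<le> c mod (4 * \<alpha>)" "c mod (4 * \<alpha>) < 4 * \<alpha>" using assms(1) by simp_all
  ultimately have "\<bar>e\<bar> \<le> 2 * \<alpha>" by (simp add: e_def algebra_simps abs_le_iff)
  then have e: "e\<^sup>2 \<le> 4 * \<alpha>\<^sup>2" using abs_le_square_iff[of e "2 * \<alpha>"] assms(1)
    by (simp add: power_mult_distrib)
  have slack: "0 \<le> 4 * t * (\<alpha> - 2) - 3 * \<alpha>\<^sup>2 - 6 * \<alpha> + 9"
  proof (cases "\<alpha> = 3")
    case True
    then show ?thesis using False by simp
  next
    case False
    then have "0 \<le> (\<alpha> - 4) * (5 * \<alpha> - 2)" using assms(1) by simp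
    moreover have "2 * \<alpha> * (\<alpha> - 2) \<le> t * (\<alpha> - 2)"
      using assms by (intro mult_right_mono) auto
    ultimately show ?thesis by (simp add: algebra_simps power2_eq_square)
  qed
  have "8 * \<alpha> * ((2 * q + 1) * (t - 1 - \<alpha> * q) + q) = c\<^sup>2 - 4 * \<alpha> - e\<^sup>2"
    by (simp add: e_def c_def power2_eq_square algebra_simps)
  moreover have "c\<^sup>2 - 4 * \<alpha> - 4 * \<alpha>\<^sup>2
      = 4 * (t * (t + 1)) - 8 + (4 * t * (\<alpha> - 2) - 3 * \<alpha>\<^sup>2 - 6 * \<alpha> + 9)"
    by (simp add: c_def power2_eq_square algebra_simps)
  ultimately have "8 * \<alpha> * \<beta> \<le> 8 * \<alpha> * ((2 * q + 1) * (t - 1 - \<alpha> * q) + q)"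
    using e slack t by linarith
  then have "\<beta> \<le> (2 * q + 1) * (t - 1 - \<alpha> * q) + q" using assms(1) by simp
  moreover have "q \<ge> 0" using assms by (simp add: q_def c_def pos_imp_zdiv_nonneg_iff)
  ultimately show ?thesis by blast
qed

lemma balanced_cover_parameters:
  fixes \<alpha> \<beta> t :: nat
  assumes "\<alpha> \<ge> 3" "\<beta> \<ge> 1" and t: "2 * \<alpha> * \<beta> + 2 \<le> t * (t + 1)"
  obtains q k where "1 + \<alpha> * q + k \<le> t" "\<beta> \<le> q * (2 * k + 1) + k"
proof (cases "\<beta> < t")
  case True
  then show ?thesis using that[of 0 \<beta>] by simp
next
  case False
  then have "t * (t + 1) \<le> \<beta> * (\<beta> + 1)" by (intro mult_le_mono) auto
  then have "\<beta> * (2 * \<alpha>) < \<beta> * (\<beta> + 1)" using t by (simp add: algebra_simps)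
  then have "2 * \<alpha> < \<beta> + 1" by (simp only: mult_less_cancel1)
  then have long: "2 * \<alpha> \<le> \<beta>" by simp
  have "2 * \<alpha> \<le> t"
  proof (rule ccontr)
    assume "\<not> 2 * \<alpha> \<le> t"
    then have "t * (t + 1) \<le> 2 * \<alpha> * (2 * \<alpha>)" by (intro mult_le_mono) auto
    also have "\<dots> \<le> 2 * \<alpha> * \<beta>" using long by simp
    finally show False using t by simp
  qed
  moreover have "2 * int \<alpha> * int \<beta> + 2 \<le> int t * (int t + 1)"
    using t[folded of_nat_le_iff[where 'a = int]] by (simp add: algebra_simps)
  ultimately obtain q where q: "q \<ge> 0"
    "int \<beta> \<le> (2 * q + 1) * (int t - 1 - int \<alpha> * q) + q"
    using long_leg_reach[of "int \<alpha>" "int t" "int \<beta>"] assms(1) by auto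
  define k where "k = int t - 1 - int \<alpha> * q"
  have "k \<ge> 0"
  proof (rule ccontr)
    assume "\<not> k \<ge> 0"
    then have "(2 * q + 1) * k \<le> (2 * q + 1) * (- 1)" using q(1) by (intro mult_left_mono) auto
    then show False using q by (simp add: k_def)
  qed
  show ?thesis
  proof (rule that[of "nat q" "nat k"])
    have "int (1 + \<alpha> * nat q + nat k) = int t" using q(1) \<open>k \<ge> 0\<close> by (simp add: k_def)
    then show "1 + \<alpha> * nat q + nat k \<le> t" by linarith
    have "int \<beta> \<le> int (nat q * (2 * nat k + 1) + nat k)"
      using q(1) q(2)[folded k_def] \<open>k \<ge> 0\<close> by (simp add: algebra_simps)
    then show "\<beta> \<le> nat q * (2 * nat k + 1) + nat k" by linarith
  qed
qed

section \<open>No balanced super-spiders\<close>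

theorem theorem3p10:
  fixes \<alpha> \<beta> :: nat
  assumes "\<alpha> \<ge> 3" and "\<beta> \<ge> 1"
  shows "\<not> super_spider (balanced_spider \<alpha> \<beta>) \<and>
    th_f (balanced_spider \<alpha> \<beta>) \<le> th_f (path_graph (\<alpha> * \<beta> + 1))"
proof -
  let ?n = "\<alpha> * \<beta> + 1"
  have verts: "pverts (path_graph ?n) = {..<?n}" by (simp add: path_graph_def)
  have le: "th_f (balanced_spider \<alpha> \<beta>) \<le> th_f (path_graph ?n)"
  proof (cases "th_f (path_graph ?n) = \<infinity>")
    case True
    then show ?thesis by simp
  next
    case False
    obtain B k where B: "B \<subseteq> {..<?n}" "{..<?n} \<subseteq> blue_after (path_graph ?n) B k"
      and th: "th_f (path_graph ?n) = enat (card B + k)"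
      using th_f_attained[OF _ False] unfolding verts by blast
    have "2 * ?n \<le> 2 * (card B * (2 * k + 1))"
      using path_graph_ball_count[OF B] by simp
    also have "\<dots> \<le> (card B + k) * (card B + k + 1)"
      by (rule twice_ball_count_le)
    finally have "2 * \<alpha> * \<beta> + 2 \<le> (card B + k) * (card B + k + 1)" by simp
    then obtain q k' where "1 + \<alpha> * q + k' \<le> card B + k" "\<beta> \<le> q * (2 * k' + 1) + k'"
      using balanced_cover_parameters assms by blast
    then show ?thesis
      using th_f_balanced_spider_le[OF assms(2), of q k' \<alpha>] th
      by (metis enat_ord_simps(1) order_trans)
  qed
  then show ?thesis
    by (simp add: super_spider_def card_pverts_balanced_spider not_less)
qed

end
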